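(* Let $\Gamma$ be the free group of rank $r\ge 1$ on free generators $a_1,\dots,a_r$, let $\Omega$ be its boundary with the probability measure $\nu$, and let $\pi$ be the quasi-regular representation of $\Gamma$ on $L^2(\Omega,\nu)$. Let $n\ge 0$ be an integer and let $f\in\mathbb{C}\Gamma$ be a finitely supported complex function on $\Gamma$ whose support is contained in the sphere $S_n=\{\gamma\in\Gamma: |\gamma|=n\}$. Then the operator $\pi(f)=\sum_{\gamma\in S_n} f(\gamma)\pi(\gamma)$ satisfies $$\|\pi(f)\|_{L^2(\Omega,\nu)\to L^2(\Omega,\nu)}\le (n+1)\,\|f\|_{\ell^2(\Gamma)}.$$
   Context: $|\gamma|$ denotes the word length of $\gamma\in\Gamma$ with respect to $\{a_j^{\pm1}\}_{j=1}^r$, and $q:=2r-1$. The boundary $\Omega$ is the set of infinite reduced words $\omega=\omega_1\omega_2\omega_3\cdots$ with letters in $\{a_j^{\pm1}\}_{j=1}^r$ (reduced: $\omega_{k+1}\ne\omega_k^{-1}$ for all $k$); $\Gamma$ acts on $\Omega$ by left multiplication (concatenate and reduce). For $g\in\Gamma$ put $\Omega_g:=\{\omega\in\Omega:\omega_1\cdots\omega_{|g|}=g\}$ (so $\Omega_e=\Omega$ for the neutral element $e$); these sets form a basis of a compact topology on $\Omega$. $\nu$ is the unique Borel probability measure on $\Omega$ with $\nu(\Omega_g)=\frac{1}{(q+1)q^{|g|-1}}$ for all $g\ne e$; it is quasi-invariant under $\Gamma$. Let $P(\gamma,\omega)=\frac{d\gamma_*\nu}{d\nu}(\omega)$ be the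 Radon–Nikodym derivative, where $\gamma_*\nu(E)=\nu(\gamma^{-1}E)$. The unitary representation $\pi$ of $\Gamma$ on $L^2(\Omega,\nu)$ (complex-valued functions) is $\pi(\gamma)\phi(\omega):=P(\gamma,\omega)^{1/2}\phi(\gamma^{-1}\omega)$. *)

theory Defs
  imports "HOL-Probability.Probability" "HOL-Algebra.Group"
begin

section \<open>The free group on a finite type of generators\<close>

text \<open>
  The free generators are the elements of a type \<open>'a\<close>, so that the rank \<open>r\<close> is \<open>CARD('a)\<close>
  (and \<open>r \<ge> 1\<close>, types being nonempty). The letter \<open>(a, True)\<close> stands for the generator \<open>a\<close>,
  and \<open>(a, False)\<close> for its inverse.
\<close>

type_synonym 'a letter = "'a \<times> bool"

definition inv_letter :: "'a letter \<Rightarrow> 'a letter" where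
  "inv_letter x = (fst x, \<not> snd x)"

definition reduced_word :: "'a letter list \<Rightarrow> bool" where
  "reduced_word w \<longleftrightarrow> successively (\<lambda>x y. y \<noteq> inv_letter x) w"

definition red_Cons :: "'a letter \<Rightarrow> 'a letter list \<Rightarrow> 'a letter list" where
  "red_Cons x w = (if w \<noteq> [] \<and> hd w = inv_letter x then tl w else x # w)"

definition free_group :: "'a letter list monoid" where
  "free_group = \<lparr>carrier = {w. reduced_word w}, mult = foldr red_Cons, one = []\<rparr>"

definition generator :: "'a \<Rightarrow> 'a letter list" where
  "generator a = [(a, True)]"

definition sym_generators :: "'a letter list set" where
  "sym_generators = range generator \<union> (\<lambda>a. inv\<^bsub>free_group\<^esub> (generator a)) ` UNIV"

definition word_length :: "'a letter list \<Rightarrow> nat" where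
  "word_length \<gamma> = (LEAST k. \<exists>xs. length xs = k \<and> set xs \<subseteq> sym_generators \<and>
     foldr (mult free_group) xs (one free_group) = \<gamma>)"

definition word_sphere :: "nat \<Rightarrow> 'a letter list set" where
  "word_sphere n = {\<gamma> \<in> carrier free_group. word_length \<gamma> = n}"

text \<open>Finitely supported functions on the group, and the \<open>\<ell>\<^sup>2\<close> norm.\<close>

definition group_algebra :: "('a letter list \<Rightarrow> complex) set" where
  "group_algebra = {f. finite {\<gamma>. f \<gamma> \<noteq> 0} \<and> {\<gamma>. f \<gamma> \<noteq> 0} \<subseteq> carrier free_group}"

definition ell2_norm :: "('a letter list \<Rightarrow> complex) \<Rightarrow> real" where
  "ell2_norm f = sqrt (\<Sum>\<^sub>\<infinity>\<gamma>\<in>carrier free_group. (cmod (f \<gamma>))\<^sup>2)"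


section \<open>The boundary\<close>

definition boundary :: "'a letter stream set" where
  "boundary = {\<omega>. \<forall>k. \<omega> !! Suc k \<noteq> inv_letter (\<omega> !! k)}"

definition red_SCons :: "'a letter \<Rightarrow> 'a letter stream \<Rightarrow> 'a letter stream" where
  "red_SCons x \<omega> = (if shd \<omega> = inv_letter x then stl \<omega> else x ## \<omega>)"

definition boundary_act :: "'a letter list \<Rightarrow> 'a letter stream \<Rightarrow> 'a letter stream" where
  "boundary_act = foldr red_SCons"

definition cyl :: "'a letter list \<Rightarrow> 'a letter stream set" where
  "cyl g = {\<omega> \<in> boundary. stake (word_length g) \<omega> = g}"

definition boundary_topology :: "'a letter stream topology" where
  "boundary_topology = topology_generated_by (cyl ` carrier free_group)"

definition boundary_borel :: "'a letter stream measure" where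
  "boundary_borel = sigma boundary {U. openin boundary_topology U}"

definition is_boundary_measure :: "'a letter stream measure \<Rightarrow> bool" where
  "is_boundary_measure M \<longleftrightarrow>
     prob_space M \<and> sets M = sets boundary_borel \<and>
     (\<forall>g \<in> carrier free_group - {one free_group}.
        let q = 2 * real CARD('a) - 1
        in measure M (cyl g) = 1 / ((q + 1) * q ^ (word_length g - 1)))"
  for M :: "'a letter stream measure"

text \<open>For existence and uniqueness see \<open>boundary_measure_ex1\<close> below.\<close>

definition boundary_measure :: "'a letter stream measure" where
  "boundary_measure = (THE M. is_boundary_measure M)"


section \<open>The quasi-regular representation\<close>

definition poisson :: "'a letter list \<Rightarrow> 'a letter stream \<Rightarrow> real" where
  "poisson \<gamma> \<omega> = enn2real (RN_deriv boundary_measure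
     (distr boundary_measure boundary_measure (boundary_act \<gamma>)) \<omega>)"

definition quasi_reg ::
  "'a letter list \<Rightarrow> ('a letter stream \<Rightarrow> complex) \<Rightarrow> 'a letter stream \<Rightarrow> complex" where
  "quasi_reg \<gamma> \<phi> \<omega> =
     complex_of_real (sqrt (poisson \<gamma> \<omega>)) * \<phi> (boundary_act (inv\<^bsub>free_group\<^esub> \<gamma>) \<omega>)"

text \<open>
  Elements of \<open>L\<^sup>2\<close> are handled through their representatives: \<open>L2_norm\<close> is a seminorm on \<open>L2\<close>
  that vanishes exactly on the functions that are zero almost everywhere. For a linear map
  of \<open>L2\<close> into itself that is bounded for this seminorm, \<open>L2_op_norm\<close> is the operator
  norm of the map it induces on the quotient; for other linear maps of \<open>L2\<close> into itself it is \<open>\<infinity>\<close>.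
  It is meaningless for maps that do not preserve \<open>L2\<close>.
\<close>

definition L2 :: "'b measure \<Rightarrow> ('b \<Rightarrow> complex) set" where
  "L2 M = {\<phi> \<in> borel_measurable M. integrable M (\<lambda>x. (cmod (\<phi> x))\<^sup>2)}"

definition L2_norm :: "'b measure \<Rightarrow> ('b \<Rightarrow> complex) \<Rightarrow> real" where
  "L2_norm M \<phi> = sqrt (\<integral>x. (cmod (\<phi> x))\<^sup>2 \<partial>M)"

definition L2_op_norm :: "'b measure \<Rightarrow> (('b \<Rightarrow> complex) \<Rightarrow> 'b \<Rightarrow> complex) \<Rightarrow> ennreal" where
  "L2_op_norm M T = (SUP \<phi> \<in> {\<phi> \<in> L2 M. L2_norm M \<phi> \<le> 1}. ennreal (L2_norm M (T \<phi>)))"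


section \<open>Basic facts\<close>

subsection \<open>Group structure and word length\<close>

lemma inv_letter_inv_letter [simp]: "inv_letter (inv_letter x) = x"
  by (simp add: inv_letter_def)

lemma inv_letter_neq [simp]: "inv_letter x \<noteq> x" "x \<noteq> inv_letter x"
  by (cases x; simp add: inv_letter_def)+

lemma reduced_word_Nil [simp]: "reduced_word []"
  by (simp add: reduced_word_def)

lemma reduced_word_Cons: "reduced_word (x # w) \<longleftrightarrow> reduced_word w \<and> (w \<noteq> [] \<longrightarrow> hd w \<noteq> inv_letter x)"
  by (cases w) (auto simp: reduced_word_def)

lemma reduced_red_Cons: "reduced_word w \<Longrightarrow> reduced_word (red_Cons x w)"
  by (cases w) (auto simp: red_Cons_def reduced_word_Cons)

lemma red_Cons_inv [simp]:
  "reduced_word w \<Longrightarrow> red_Cons (inv_letter x) (red_Cons x w) = w"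
  "reduced_word w \<Longrightarrow> red_Cons x (red_Cons (inv_letter x) w) = w"
  by (cases w; auto simp: red_Cons_def reduced_word_Cons)+

lemma reduced_foldr: "reduced_word v \<Longrightarrow> reduced_word (foldr red_Cons u v)"
  by (induction u) (auto simp: reduced_red_Cons)

lemma foldr_red_Cons_Nil: "reduced_word u \<Longrightarrow> foldr red_Cons u [] = u"
  by (induction u) (auto simp: reduced_word_Cons red_Cons_def)

lemma foldr_red_Cons_red_Cons:
  assumes "reduced_word v"
  shows "foldr red_Cons (red_Cons x w) v = red_Cons x (foldr red_Cons w v)"
proof (cases w)
  case (Cons y ys)
  show ?thesis
  proof (cases "y = inv_letter x")
    case True
    have "red_Cons x (red_Cons (inv_letter x) (foldr red_Cons ys v)) = foldr red_Cons ys v"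
      using assms by (simp add: reduced_foldr)
    moreover have "red_Cons x w = ys" using True Cons by (simp add: red_Cons_def)
    ultimately show ?thesis using True Cons by simp
  qed (simp add: Cons red_Cons_def[of x "y # ys"])
qed (simp add: red_Cons_def)

lemma foldr_red_Cons_assoc:
  assumes "reduced_word w"
  shows "foldr red_Cons (foldr red_Cons u v) w = foldr red_Cons u (foldr red_Cons v w)"
  using assms by (induction u) (simp_all add: foldr_red_Cons_red_Cons)

definition inv_word :: "'a letter list \<Rightarrow> 'a letter list" where
  "inv_word w = rev (map inv_letter w)"

lemma foldr_inv_word:
  "reduced_word v \<Longrightarrow> foldr red_Cons (inv_word u) (foldr red_Cons u v) = v"
  by (induction u) (simp_all add: inv_word_def reduced_foldr)

lemma reduced_inv_word: "reduced_word w \<Longrightarrow> reduced_word (inv_word w)"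
  unfolding reduced_word_def inv_word_def
  by (auto simp: successively_map successively_rev elim!: successively_mono)

lemma carrier_free_group [simp]: "w \<in> carrier free_group \<longleftrightarrow> reduced_word w"
  by (simp add: free_group_def)

lemma mult_free_group: "mult free_group u v = foldr red_Cons u v"
  by (simp add: free_group_def)

lemma one_free_group: "one free_group = []"
  by (simp add: free_group_def)

lemma group_free_group: "group free_group"
proof (rule groupI)
  fix x :: "'a letter list" assume "x \<in> carrier free_group"
  then have "inv_word x \<in> carrier free_group \<and> inv_word x \<otimes>\<^bsub>free_group\<^esub> x = \<one>\<^bsub>free_group\<^esub>"
    using foldr_inv_word[of "[]" x]
    by (simp add: mult_free_group one_free_group reduced_inv_word foldr_red_Cons_Nil)
  then show "\<exists>y\<in>carrier free_group. y \<otimes>\<^bsub>free_group\<^esub> x = \<one>\<^bsub>free_group\<^esub>"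
    by blast
qed (auto simp: mult_free_group one_free_group reduced_foldr foldr_red_Cons_assoc)

lemma inv_free_group:
  assumes "reduced_word w" shows "inv\<^bsub>free_group\<^esub> w = inv_word w"
  using assms foldr_inv_word[of "[]" w] group_free_group
  by (intro group.inv_equality)
     (simp_all add: mult_free_group one_free_group reduced_inv_word foldr_red_Cons_Nil)

lemma sym_generators_eq: "sym_generators = range (\<lambda>x. [x])"
proof -
  have "inv\<^bsub>free_group\<^esub> (generator a) = [(a, False)]" for a :: 'a
    by (subst inv_free_group) (auto simp: generator_def reduced_word_Cons inv_word_def inv_letter_def)
  then show ?thesis
    by (auto simp: sym_generators_def generator_def image_iff split_paired_all)
qed

lemma length_red_Cons: "length (red_Cons x w) \<le> Suc (length w)"
  by (auto simp: red_Cons_def)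

lemma word_length_eq: "reduced_word w \<Longrightarrow> word_length w = length w"
  unfolding word_length_def
proof (rule Least_equality)
  assume w: "reduced_word w"
  have "foldr (mult free_group) (map (\<lambda>x. [x]) u) v = foldr red_Cons u v" for u v :: "'a letter list"
    by (induction u) (auto simp: mult_free_group)
  then show "\<exists>xs. length xs = length w \<and> set xs \<subseteq> sym_generators \<and>
      foldr (mult free_group) xs (one free_group) = w"
    using w by (intro exI[of _ "map (\<lambda>x. [x]) w"])
      (auto simp: sym_generators_eq one_free_group foldr_red_Cons_Nil)
next
  fix k assume "\<exists>xs. length xs = k \<and> set xs \<subseteq> sym_generators \<and>
      foldr (mult free_group) xs (one free_group) = w"
  then obtain xs where xs: "length xs = k" "set xs \<subseteq> sym_generators"
      "foldr (mult free_group) xs (one free_group) = w" by blast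
  have "set xs \<subseteq> sym_generators \<Longrightarrow>
      length (foldr (mult free_group) xs (one free_group)) \<le> length xs"
  proof (induction xs)
    case (Cons a xs)
    then obtain x where "a = [x]" by (auto simp: sym_generators_eq)
    then have "foldr (mult free_group) (a # xs) (one free_group) =
        red_Cons x (foldr (mult free_group) xs (one free_group))"
      by (simp add: mult_free_group)
    then show ?case using Cons
        length_red_Cons[of x "foldr (mult free_group) xs (one free_group)"]
      by simp
  qed (simp add: one_free_group)
  then show "length w \<le> k" using xs by simp
qed


subsection \<open>Existence and uniqueness of the boundary measure\<close>

lemma cyl_eq: "reduced_word g \<Longrightarrow> cyl g = {\<omega> \<in> boundary. stake (length g) \<omega> = g}"
  by (simp add: cyl_def word_length_eq)

lemma cyl_Nil [simp]: "cyl [] = boundary"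
  by (simp add: cyl_eq)

lemma cyl_subset: "cyl g \<subseteq> boundary"
  by (auto simp: cyl_def)

lemma cyl_Int_aux:
  assumes "reduced_word g" "reduced_word h" "length g \<le> length h"
  shows "cyl g \<inter> cyl h \<in> {cyl h, {}}"
proof (cases "take (length g) h = g")
  case True
  have "cyl h \<subseteq> cyl g"
  proof
    fix \<omega> assume "\<omega> \<in> cyl h"
    then have w: "\<omega> \<in> boundary" "stake (length h) \<omega> = h" using assms by (auto simp: cyl_eq)
    have "stake (length g) \<omega> = take (length g) (stake (length h) \<omega>)"
      using assms(3) by (simp add: take_stake min_def)
    then show "\<omega> \<in> cyl g" using w True assms by (simp add: cyl_eq)
  qed
  then show ?thesis by blast
next
  case False
  have "\<omega> \<notin> cyl g \<inter> cyl h" for \<omega>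
  proof
    assume "\<omega> \<in> cyl g \<inter> cyl h"
    then have "stake (length g) \<omega> = g" "stake (length h) \<omega> = h" using assms by (auto simp: cyl_eq)
    moreover have "stake (length g) \<omega> = take (length g) (stake (length h) \<omega>)"
      using assms(3) by (simp add: take_stake min_def)
    ultimately show False using False by simp
  qed
  then show ?thesis by blast
qed

lemma cyl_Int:
  assumes "reduced_word g" "reduced_word h"
  shows "cyl g \<inter> cyl h \<in> {cyl g, cyl h, {}}"
  using cyl_Int_aux[of g h] cyl_Int_aux[of h g] assms
  by (cases "length g \<le> length h") (auto simp: Int_commute)

lemma openin_boundary_cyl:
  assumes "openin boundary_topology U" "\<omega> \<in> U"
  shows "\<exists>g. reduced_word g \<and> \<omega> \<in> cyl g \<and> cyl g \<subseteq> U"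
proof -
  have "generate_topology_on (cyl ` carrier free_group) U"
    using assms(1) by (simp add: boundary_topology_def openin_topology_generated_by_iff)
  then have "\<forall>\<omega>\<in>U. \<exists>g. reduced_word g \<and> \<omega> \<in> cyl g \<and> cyl g \<subseteq> U"
  proof induction
    case (Int a b)
    show ?case
    proof
      fix \<omega> assume "\<omega> \<in> a \<inter> b"
      then obtain g h where gh: "reduced_word g" "\<omega> \<in> cyl g" "cyl g \<subseteq> a" "reduced_word h" "\<omega> \<in> cyl h" "cyl h \<subseteq> b"
        using Int.IH by blast
      then have "cyl g \<inter> cyl h \<in> {cyl g, cyl h}" using cyl_Int[of g h] by blast
      then show "\<exists>g. reduced_word g \<and> \<omega> \<in> cyl g \<and> cyl g \<subseteq> a \<inter> b" using gh by blast
    qed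
  next
    case (UN K)
    then show ?case by (meson Union_iff Union_upper subset_trans)
  next
    case (Basis s)
    then obtain g where "reduced_word g" "s = cyl g" by auto
    then show ?case by blast
  qed simp
  then show ?thesis using assms(2) by blast
qed

lemma sets_boundary_borel:
  "sets (boundary_borel :: 'a::finite letter stream measure) =
     sigma_sets boundary (cyl ` carrier free_group)"
  and space_boundary_borel [simp]: "space (boundary_borel :: 'a letter stream measure) = boundary"
proof -
  let ?E = "cyl ` carrier free_group :: 'a letter stream set set"
  let ?O = "{U. openin boundary_topology U} :: 'a letter stream set set"
  have EO: "?E \<subseteq> ?O"
    by (auto simp: boundary_topology_def intro!: topology_generated_by_Basis)
  have OP: "?O \<subseteq> Pow boundary"
    using openin_boundary_cyl cyl_subset by blast
  have "U \<in> sigma_sets boundary ?E" if "U \<in> ?O" for U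
  proof -
    let ?G = "{g. reduced_word g \<and> cyl g \<subseteq> U}"
    have "U = (\<Union>g\<in>?G. cyl g)"
      using openin_boundary_cyl[of U] that by blast
    moreover have "(\<Union>(cyl ` ?G)) \<in> sigma_sets boundary ?E"
    proof (rule sigma_algebra.countable_UN''[OF sigma_algebra_sigma_sets])
      have "countable (lists (UNIV :: 'a letter set))" by (rule countable_lists) simp
      then show "countable ?G" by (rule countable_subset[rotated]) auto
      show "cyl x \<in> sigma_sets boundary ?E" if "x \<in> ?G" for x
        using that by (auto intro!: sigma_sets.Basic)
    qed (use EO OP in blast)
    ultimately show ?thesis by simp
  qed
  then have "sigma_sets boundary ?O = sigma_sets boundary ?E"
    using EO OP by (intro sigma_sets_eqI) auto
  then show "sets boundary_borel = sigma_sets boundary ?E"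
    using OP by (simp add: boundary_borel_def sets_measure_of)
  show "space (boundary_borel :: 'a letter stream measure) = boundary"
    using OP by (simp add: boundary_borel_def space_measure_of)
qed

lemma is_boundary_measure_cyl:
  fixes M :: "'a::finite letter stream measure"
  assumes "is_boundary_measure M" "reduced_word g" "g \<noteq> []"
  shows "measure M (cyl g) =
    1 / (2 * real CARD('a) * (2 * real CARD('a) - 1) ^ (length g - 1))"
proof -
  have "g \<in> carrier free_group - {one free_group}"
    using assms by (simp add: one_free_group)
  then have "measure M (cyl g) = (let q = 2 * real CARD('a) - 1
        in 1 / ((q + 1) * q ^ (word_length g - 1)))"
    using assms(1) unfolding is_boundary_measure_def Let_def by blast
  then show ?thesis using assms by (simp add: Let_def word_length_eq)
qed

lemma boundary_measure_unique:
  fixes M N :: "'a::finite letter stream measure"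
  assumes M: "is_boundary_measure M" and N: "is_boundary_measure N"
  shows "M = N"
proof -
  interpret M: prob_space M using M by (simp add: is_boundary_measure_def)
  interpret N: prob_space N using N by (simp add: is_boundary_measure_def)
  have sM: "sets M = sets boundary_borel" and sN: "sets N = sets boundary_borel"
    using M N by (simp_all add: is_boundary_measure_def)
  have sp: "space M = boundary" "space N = boundary"
    using sets_eq_imp_space_eq[OF sM] sets_eq_imp_space_eq[OF sN] by simp_all
  let ?E = "insert {} (cyl ` carrier free_group) :: 'a letter stream set set"
  have sE: "sigma_sets boundary ?E = sigma_sets boundary (cyl ` carrier free_group)"
    by (rule sigma_sets_eqI) (auto intro: sigma_sets.intros)
  show ?thesis
  proof (rule measure_eqI_generator_eq[where E = ?E and \<Omega> = boundary and A = "\<lambda>_. boundary"])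
    show "Int_stable ?E"
    proof (rule Int_stableI)
      fix a b assume "a \<in> ?E" "b \<in> ?E"
      then show "a \<inter> b \<in> ?E" using cyl_Int by fastforce
    qed
    show "?E \<subseteq> Pow boundary" using cyl_subset by blast
    show "sets M = sigma_sets boundary ?E" "sets N = sigma_sets boundary ?E"
      unfolding sM sN sE sets_boundary_borel by simp_all
    show "range (\<lambda>_. boundary) \<subseteq> ?E"
      using cyl_Nil reduced_word_Nil by (auto intro!: rev_image_eqI[of "[]"])
    show "emeasure M X = emeasure N X" if "X \<in> ?E" for X
    proof -
      have "X = {} \<or> (\<exists>g. reduced_word g \<and> X = cyl g)" using that by auto
      then consider "X = {}" | "X = boundary" | g where "reduced_word g" "g \<noteq> []" "X = cyl g"
        using cyl_Nil by blast
      then show ?thesis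
      proof cases
        case 2
        then show ?thesis using M.emeasure_space_1 N.emeasure_space_1 sp by simp
      next
        case 3
        then show ?thesis
          using is_boundary_measure_cyl[OF M] is_boundary_measure_cyl[OF N]
          by (simp add: M.emeasure_eq_measure N.emeasure_eq_measure)
      qed simp
    qed
  qed (use sp in \<open>auto simp: M.emeasure_eq_measure\<close>)
qed

text \<open>For existence, the letters of a random reduced word are chosen one after the other.\<close>

definition next_letter :: "'a::finite letter \<Rightarrow> nat \<Rightarrow> 'a letter" where
  "next_letter x = (SOME h. bij_betw h {..<2 * CARD('a) - 1} (UNIV - {inv_letter x}))"

primcorec walk :: "'a::finite letter \<Rightarrow> nat stream \<Rightarrow> 'a letter stream" where
  "shd (walk x s) = next_letter x (shd s mod (2 * CARD('a) - 1))"
| "stl (walk x s) = walk (next_letter x (shd s mod (2 * CARD('a) - 1))) (stl s)"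

lemma bij_next_letter:
  "bij_betw (next_letter x) {..<2 * CARD('a) - 1} (UNIV - {inv_letter x})"
  for x :: "'a::finite letter"
proof -
  have "card (UNIV :: 'a letter set) = 2 * CARD('a)"
    by (simp add: card_UNIV_bool)
  then have "card {..<2 * CARD('a) - 1} = card (UNIV - {inv_letter x})"
    by (simp add: card_Diff_singleton)
  then have "\<exists>h. bij_betw h {..<2 * CARD('a) - 1} (UNIV - {inv_letter x})"
    by (intro finite_same_card_bij) auto
  then show ?thesis unfolding next_letter_def by (rule someI_ex)
qed

lemma CARD_pos: "2 * CARD('a::finite) - 1 > 0"
  using zero_less_card_finite[where 'a='a] by linarith

lemma next_letter_neq:
  "next_letter x (k mod (2 * CARD('a) - 1)) \<noteq> inv_letter x" for x :: "'a::finite letter"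
  using bij_betw_apply[OF bij_next_letter, of "k mod (2 * CARD('a) - 1)" x] CARD_pos[where 'a='a]
  by auto

lemma walk_boundary: "x ## walk x s \<in> boundary" for x :: "'a::finite letter"
proof -
  have "(x ## walk x s) !! Suc k \<noteq> inv_letter ((x ## walk x s) !! k)" for k
  proof (induction k arbitrary: x s)
    case 0
    then show ?case using next_letter_neq[of x "shd s"] by simp
  next
    case (Suc k)
    have *: "shd (walk x s) ## walk (shd (walk x s)) (stl s) = walk x s"
      by (subst (3) walk.code) simp
    show ?case using Suc[of "shd (walk x s)" "stl s"] unfolding * by (simp del: walk.simps)
  qed
  then show ?thesis by (simp add: boundary_def)
qed

definition steps :: "'a::finite itself \<Rightarrow> nat measure" where
  "steps _ = measure_pmf (pmf_of_set {..<2 * CARD('a) - 1})"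

lemma prob_space_steps: "prob_space (steps TYPE('a::finite))"
  by (simp add: steps_def measure_pmf.prob_space_axioms)

lemma sets_steps [simp]: "sets (steps TYPE('a::finite)) = UNIV"
  by (simp add: steps_def)

lemma space_steps [simp]: "space (steps TYPE('a::finite)) = UNIV"
  by (simp add: steps_def)

lemma space_stream_steps [simp]: "space (stream_space (steps TYPE('a::finite))) = UNIV"
  by (simp add: space_stream_space)

lemma walk_Cons:
  "stake (Suc n) (walk x s) = y # g \<longleftrightarrow>
     next_letter x (shd s mod (2 * CARD('a) - 1)) = y \<and> stake n (walk y (stl s)) = g"
  for x :: "'a::finite letter"
  by auto

lemma walk_sets:
  fixes x :: "'a::finite letter"
  shows "{s. stake (length g) (walk x s) = g} \<in> sets (stream_space (steps TYPE('a)))"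
proof (induction g arbitrary: x)
  case Nil
  then show ?case using sets.top[of "stream_space (steps TYPE('a))"] by simp
next
  case (Cons y g)
  let ?S = "stream_space (steps TYPE('a))"
  have 1: "shd -` {k. next_letter x (k mod (2 * CARD('a) - 1)) = y} \<inter> space ?S \<in> sets ?S"
    by (rule measurable_sets[OF measurable_shd]) simp
  have 2: "stl -` {s. stake (length g) (walk y s) = g} \<inter> space ?S \<in> sets ?S"
    by (rule measurable_sets[OF measurable_stl Cons])
  have "{s. stake (length (y # g)) (walk x s) = y # g} =
    (shd -` {k. next_letter x (k mod (2 * CARD('a) - 1)) = y} \<inter> space ?S) \<inter>
    (stl -` {s. stake (length g) (walk y s) = g} \<inter> space ?S)"
    by (auto simp del: stake.simps simp: walk_Cons)
  then show ?case using sets.Int[OF 1 2] by simp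
qed

lemma emeasure_steps:
  fixes x y :: "'a::finite letter"
  assumes "y \<noteq> inv_letter x"
  shows "emeasure (steps TYPE('a)) {k. next_letter x (k mod (2 * CARD('a) - 1)) = y} =
    ennreal (1 / (2 * real CARD('a) - 1))"
proof -
  let ?q = "2 * CARD('a) - 1"
  have q: "?q > 0" by (rule CARD_pos)
  obtain k where k: "k < ?q" "next_letter x k = y"
    using bij_next_letter[of x] assms unfolding bij_betw_def by (metis DiffI UNIV_I imageE lessThan_iff singletonD)
  have "{..<?q} \<inter> {k. next_letter x (k mod ?q) = y} = {k}"
    using k bij_next_letter[of x] unfolding bij_betw_def inj_on_def by auto
  moreover have "{..<?q} \<noteq> {}" using q by (metis empty_iff lessThan_iff)
  ultimately have "emeasure (steps TYPE('a)) {k. next_letter x (k mod ?q) = y} = ennreal (1 / real ?q)"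
    unfolding steps_def by (subst emeasure_pmf_of_set) (auto simp: ennreal_of_nat_eq_real_of_nat divide_ennreal q)
  then show ?thesis using q by (simp add: of_nat_diff)
qed

lemma emeasure_walk:
  fixes x :: "'a::finite letter"
  assumes "reduced_word (x # g)"
  shows "emeasure (stream_space (steps TYPE('a))) {s. stake (length g) (walk x s) = g} =
    ennreal ((1 / (2 * real CARD('a) - 1)) ^ length g)"
  using assms
proof (induction g arbitrary: x)
  case Nil
  show ?case
    using prob_space.emeasure_space_1[OF prob_space.prob_space_stream_space[OF prob_space_steps[where 'a='a]]]
    by simp
next
  case (Cons y g)
  let ?q = "2 * CARD('a) - 1"
  let ?S = "stream_space (steps TYPE('a))"
  let ?c = "ennreal ((1 / (2 * real CARD('a) - 1)) ^ length g)"
  have yx: "y \<noteq> inv_letter x" and r: "reduced_word (y # g)" using Cons.prems by (auto simp: reduced_word_Cons)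
  have q: "2 * real CARD('a) - 1 \<ge> 0" using CARD_pos[where 'a='a] by simp
  have eq: "emeasure ?S {s \<in> space ?S. t ## s \<in> {s. stake (length (y # g)) (walk x s) = y # g}} =
      ?c * indicator {k. next_letter x (k mod ?q) = y} t" for t
  proof (cases "next_letter x (t mod ?q) = y")
    case True
    then have "{s \<in> space ?S. t ## s \<in> {s. stake (length (y # g)) (walk x s) = y # g}} =
        {s. stake (length g) (walk y s) = g}"
      by (auto simp del: stake.simps simp: walk_Cons)
    then show ?thesis using True Cons.IH[OF r] by simp
  next
    case False
    then have "{s \<in> space ?S. t ## s \<in> {s. stake (length (y # g)) (walk x s) = y # g}} = {}"
      by (auto simp del: stake.simps simp: walk_Cons)
    then show ?thesis using False by simp
  qed
  have "emeasure ?S {s. stake (length (y # g)) (walk x s) = y # g} =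
    (\<integral>\<^sup>+t. ?c * indicator {k. next_letter x (k mod ?q) = y} t \<partial>steps TYPE('a))"
    using prob_space.emeasure_stream_space[OF prob_space_steps walk_sets[of "y # g" x]]
    unfolding eq .
  also have "\<dots> = ?c * emeasure (steps TYPE('a)) {k. next_letter x (k mod ?q) = y}"
    by (rule nn_integral_cmult_indicator) simp
  also have "\<dots> = ?c * ennreal (1 / (2 * real CARD('a) - 1))"
    by (simp only: emeasure_steps[OF yx])
  also have "\<dots> = ennreal ((1 / (2 * real CARD('a) - 1)) ^ length (y # g))"
    using q by (simp add: ennreal_mult'[symmetric] mult.commute)
  finally show ?case .
qed

lemma boundary_measure_ex: "\<exists>M :: 'a::finite letter stream measure. is_boundary_measure M"
proof -
  let ?U = "measure_pmf (pmf_of_set (UNIV :: 'a letter set))"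
  let ?S = "stream_space (steps TYPE('a))"
  let ?F = "\<lambda>(x :: 'a letter, s). x ## walk x s"
  interpret S: prob_space ?S
    by (rule prob_space.prob_space_stream_space[OF prob_space_steps])
  interpret P: pair_prob_space ?U ?S ..
  have pre: "?F -` cyl (y # g) \<inter> space (?U \<Otimes>\<^sub>M ?S) = {y} \<times> {s. stake (length g) (walk y s) = g}"
    if "reduced_word (y # g)" for y g
    using that walk_boundary by (auto simp: cyl_eq space_pair_measure)
  have F: "?F \<in> measurable (?U \<Otimes>\<^sub>M ?S) boundary_borel"
  proof (rule measurable_sigma_sets[OF sets_boundary_borel])
    show "cyl ` carrier free_group \<subseteq> Pow boundary" using cyl_subset by blast
    show "?F \<in> space (?U \<Otimes>\<^sub>M ?S) \<rightarrow> boundary" using walk_boundary by auto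
    fix Y :: "'a letter stream set" assume "Y \<in> cyl ` carrier free_group"
    then obtain g where g: "reduced_word g" "Y = cyl g" by auto
    show "?F -` Y \<inter> space (?U \<Otimes>\<^sub>M ?S) \<in> sets (?U \<Otimes>\<^sub>M ?S)"
    proof (cases g)
      case Nil
      then have "?F -` Y \<inter> space (?U \<Otimes>\<^sub>M ?S) = space (?U \<Otimes>\<^sub>M ?S)"
        using g walk_boundary by auto
      then show ?thesis by simp
    next
      case (Cons y h)
      then show ?thesis using g pre[of y h] walk_sets[of h y] by (auto intro!: pair_measureI)
    qed
  qed
  let ?M = "distr (?U \<Otimes>\<^sub>M ?S) boundary_borel ?F"
  have "measure ?M (cyl g) = 1 / (2 * real CARD('a) * (2 * real CARD('a) - 1) ^ (length g - 1))"
    if g: "reduced_word g" "g \<noteq> []" for g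
  proof -
    obtain y h where yh: "g = y # h" using g by (cases g) auto
    have cg: "cyl g \<in> sets boundary_borel"
      using g by (auto simp: sets_boundary_borel intro!: sigma_sets.Basic)
    have q: "2 * real CARD('a) - 1 \<ge> 0" using CARD_pos[where 'a='a] by simp
    have U: "emeasure ?U {y} = ennreal (1 / (2 * real CARD('a)))"
      by (simp add: emeasure_pmf_single card_UNIV_bool)
    have "emeasure ?M (cyl g) = emeasure (?U \<Otimes>\<^sub>M ?S) ({y} \<times> {s. stake (length h) (walk y s) = h})"
      using pre[of y h] g unfolding emeasure_distr[OF F cg] by (simp only: yh)
    also have "\<dots> = emeasure ?U {y} * emeasure ?S {s. stake (length h) (walk y s) = h}"
      by (rule S.emeasure_pair_measure_Times) (auto simp: walk_sets)
    also have "\<dots> = ennreal (1 / (2 * real CARD('a)) * (1 / (2 * real CARD('a) - 1)) ^ length h)"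
      using g yh q by (simp only: U emeasure_walk) (simp add: ennreal_mult'[symmetric])
    finally show ?thesis
      using q yh by (simp add: measure_def power_one_over field_simps)
  qed
  moreover have "prob_space ?M" by (rule P.prob_space_distr[OF F])
  ultimately have "is_boundary_measure ?M"
    unfolding is_boundary_measure_def Let_def
    by (auto simp: one_free_group word_length_eq)
  then show ?thesis by blast
qed

theorem boundary_measure_ex1: "\<exists>!M :: 'a::finite letter stream measure. is_boundary_measure M"
  using boundary_measure_ex boundary_measure_unique by blast

theorem is_boundary_measure_boundary_measure:
  "is_boundary_measure (boundary_measure :: 'a::finite letter stream measure)"
  unfolding boundary_measure_def by (rule theI'[OF boundary_measure_ex1])

end

(* Split the sum over the sphere according to the length k = 0, ..., n of the common prefix
   of u and \<omega>. By Cauchy-Schwarz, the square of the k-th piece at \<omega> is at most the sum of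
   |f u|^2 over all u starting with the first k letters of \<omega>, times a weight that depends on
   \<phi>. Cancelling exactly the first k letters of u in u^-1 \<omega> leaves a point starting
   with the inverse of the rest of u; over each cylinder of level k these starts are
   distinct for distinct u, so quasi-invariance bounds the integral of the weight over
   the cylinder by the squared norm of \<phi>. Hence each of the n + 1 pieces has operator norm
   at most the l^2 norm of f. *)

theory Submission
  imports Defs
begin

section \<open>The action on the boundary\<close>

lemma boundary_SCons:
  "x ## \<omega> \<in> boundary \<longleftrightarrow> shd \<omega> \<noteq> inv_letter x \<and> \<omega> \<in> boundary"
proof -
  have "(\<forall>k. P k) \<longleftrightarrow> P 0 \<and> (\<forall>k. P (Suc k))" for P :: "nat \<Rightarrow> bool"
    by (metis not0_implies_Suc)
  from this[of "\<lambda>k. (x ## \<omega>) !! Suc k \<noteq> inv_letter ((x ## \<omega>) !! k)"] show ?thesis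
    by (simp add: boundary_def)
qed

lemma stl_boundary: "\<omega> \<in> boundary \<Longrightarrow> stl \<omega> \<in> boundary"
  by (metis boundary_SCons stream.collapse)

lemma red_SCons_boundary: "\<omega> \<in> boundary \<Longrightarrow> red_SCons x \<omega> \<in> boundary"
  by (simp add: red_SCons_def boundary_SCons stl_boundary)

text \<open>If \<open>x\<close> cancels the first letter of \<open>\<omega>\<close>, reducedness
  keeps the next letter from being \<open>x\<close>, so \<open>inv_letter x\<close> is put back
  instead of cancelling again.\<close>

lemma red_SCons_inv_letter:
  assumes "\<omega> \<in> boundary"
  shows "red_SCons (inv_letter x) (red_SCons x \<omega>) = \<omega>"
proof -
  have "shd (stl \<omega>) \<noteq> inv_letter (shd \<omega>)"
    using assms by (metis boundary_SCons stream.collapse)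
  then show ?thesis
    by (cases \<omega>) (auto simp: red_SCons_def)
qed

lemma boundary_act_simps [simp]:
  "boundary_act [] \<omega> = \<omega>"
  "boundary_act (x # u) \<omega> = red_SCons x (boundary_act u \<omega>)"
  "boundary_act (u @ v) \<omega> = boundary_act u (boundary_act v \<omega>)"
  by (simp_all add: boundary_act_def)

lemma boundary_act_boundary: "\<omega> \<in> boundary \<Longrightarrow> boundary_act u \<omega> \<in> boundary"
  by (induction u) (simp_all add: red_SCons_boundary)

lemma boundary_act_inv_word:
  "\<omega> \<in> boundary \<Longrightarrow> boundary_act (inv_word u) (boundary_act u \<omega>) = \<omega>"
  by (induction u) (simp_all add: inv_word_def red_SCons_inv_letter boundary_act_boundary)

lemma boundary_act_inv_word_shift: "boundary_act (inv_word u) (u @- \<omega>) = \<omega>"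
  by (induction u) (simp_all add: inv_word_def red_SCons_def)

text \<open>No cancellation occurs inside a reduced \<open>u\<close>, and the condition on
  \<open>last u\<close> excludes it at the junction with \<open>\<omega>\<close>.\<close>

lemma boundary_act_eq_shift:
  assumes "reduced_word u" "u \<noteq> [] \<Longrightarrow> shd \<omega> \<noteq> inv_letter (last u)"
  shows "boundary_act u \<omega> = u @- \<omega>"
  using assms
proof (induction u)
  case (Cons x u)
  then show ?case
    by (cases u) (auto simp: reduced_word_Cons red_SCons_def)
qed simp

lemma reduced_word_drop: "reduced_word u \<Longrightarrow> reduced_word (drop k u)"
proof (induction k arbitrary: u)
  case (Suc k)
  then show ?case by (cases u) (auto simp: reduced_word_Cons)
qed simp

lemma reduced_word_stake: "\<omega> \<in> boundary \<Longrightarrow> reduced_word (stake k \<omega>)"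
proof (induction k arbitrary: \<omega>)
  case (Suc k)
  have "shd (stl \<omega>) \<noteq> inv_letter (shd \<omega>)"
    using Suc.prems by (metis boundary_SCons stream.collapse)
  then show ?case
    using Suc by (cases k) (auto simp: reduced_word_Cons stl_boundary)
qed simp


section \<open>The overlap of a word and a boundary point\<close>

text \<open>The longest common prefix has exactly \<open>k\<close> letters. The value
  \<open>k = length u\<close> is included: then \<open>take (Suc k) u\<close> is \<open>u\<close>
  itself, too short to equal \<open>stake (Suc k) \<omega>\<close>.\<close>

definition overlaps :: "nat \<Rightarrow> 'a letter list \<Rightarrow> 'a letter stream \<Rightarrow> bool" where
  "overlaps k u \<omega> \<longleftrightarrow> take k u = stake k \<omega> \<and> take (Suc k) u \<noteq> stake (Suc k) \<omega>"

lemma overlaps_ex: "\<exists>k\<le>length u. overlaps k u \<omega>"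
proof -
  let ?P = "\<lambda>k. take k u \<noteq> stake k \<omega>"
  \<comment> \<open>Past the end of \<open>u\<close> the lengths differ, so some prefix length
    fails; the overlap is one less than the first failing one.\<close>
  have "length (take (Suc (length u)) u) \<noteq> length (stake (Suc (length u)) \<omega>)"
    unfolding length_stake by simp
  then have "?P (Suc (length u))" by metis
  moreover have "\<not> ?P 0" by simp
  ultimately obtain k where "k < Suc (length u)" "\<forall>i\<le>k. \<not> ?P i" "?P (Suc k)"
    using ex_least_nat_less[of ?P] by blast
  then show ?thesis unfolding overlaps_def by (meson less_Suc_eq_le order_refl)
qed

lemma overlaps_le_length: "overlaps k u \<omega> \<Longrightarrow> k \<le> length u"
  by (metis overlaps_def length_stake length_take min.cobounded1)

text \<open>The common prefix cancels, leaving the inverse of \<open>drop k u\<close> to act on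
  \<open>sdrop k \<eta>\<close>. Cancellation stops there because the next letters of
  \<open>u\<close> and \<open>\<eta>\<close> differ, or because \<open>u\<close> is
  exhausted.\<close>

lemma overlaps_boundary_act:
  assumes "reduced_word u" "overlaps k u \<eta>"
  shows "boundary_act (inv_word u) \<eta> = inv_word (drop k u) @- sdrop k \<eta>"
proof -
  have k: "k \<le> length u" using assms overlaps_le_length by blast
  have "u = take k u @ drop k u" by simp
  then have "inv_word u = inv_word (drop k u) @ inv_word (take k u)"
    by (metis inv_word_def map_append rev_append)
  moreover have "\<eta> = take k u @- sdrop k \<eta>"
    using assms(2) by (simp add: overlaps_def stake_sdrop)
  ultimately have "boundary_act (inv_word u) \<eta> = boundary_act (inv_word (drop k u)) (sdrop k \<eta>)"
    by (metis boundary_act_simps(3) boundary_act_inv_word_shift)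
  also have "\<dots> = inv_word (drop k u) @- sdrop k \<eta>"
  proof (rule boundary_act_eq_shift)
    show "reduced_word (inv_word (drop k u))"
      using assms(1) by (intro reduced_inv_word reduced_word_drop)
    assume "inv_word (drop k u) \<noteq> []"
    then have "k < length u" by (auto simp: inv_word_def)
    then have "last (inv_word (drop k u)) = inv_letter (u ! k)"
      by (simp add: inv_word_def last_rev hd_map hd_drop_conv_nth)
    \<comment> \<open>The prefixes of length \<open>k\<close> agree and those of length
      \<open>Suc k\<close> do not, so the mismatch sits at index \<open>k\<close>.\<close>
    moreover have "u ! k \<noteq> \<eta> !! k"
      using assms(2) \<open>k < length u\<close>
      by (auto simp: overlaps_def take_Suc_conv_app_nth stake_Suc simp del: stake.simps(2))
    ultimately show "shd (sdrop k \<eta>) \<noteq> inv_letter (last (inv_word (drop k u)))"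
      by simp
  qed
  finally show ?thesis .
qed

text \<open>Apply the preceding formula at \<open>\<eta> = boundary_act u \<omega>\<close>, where
  \<open>inv_word u\<close> gives back \<open>\<omega>\<close>. Hence \<open>\<omega>\<close>,
  \<open>k\<close> and the length of \<open>u\<close> determine \<open>drop k u\<close>, which later
  yields disjointness.\<close>

lemma overlaps_boundary_act_stake:
  assumes "reduced_word u" "\<omega> \<in> boundary" "overlaps k u (boundary_act u \<omega>)"
  shows "stake (length u - k) \<omega> = inv_word (drop k u)"
proof -
  have "\<omega> = inv_word (drop k u) @- sdrop k (boundary_act u \<omega>)"
    using overlaps_boundary_act[OF assms(1,3)] assms(2) by (simp add: boundary_act_inv_word)
  then show ?thesis
    by (metis (no_types, lifting) inv_word_def length_drop length_map length_rev stake_shift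
        cancel_comm_monoid_add_class.diff_cancel append_Nil2 order_refl stake.simps(1) take_all)
qed


section \<open>The boundary measure and its quasi-invariance\<close>

lemma
  shows prob_space_boundary_measure: "prob_space (boundary_measure :: 'a::finite letter stream measure)"
    and sets_boundary_measure:
      "sets (boundary_measure :: 'a letter stream measure) = sigma_sets boundary (cyl ` carrier free_group)"
    and space_boundary_measure [simp]:
      "space (boundary_measure :: 'a letter stream measure) = boundary"
proof -
  have *: "is_boundary_measure (boundary_measure :: 'a letter stream measure)"
    by (rule is_boundary_measure_boundary_measure)
  then show "prob_space (boundary_measure :: 'a letter stream measure)"
    by (simp add: is_boundary_measure_def)
  from * have s: "sets (boundary_measure :: 'a letter stream measure) = sets boundary_borel"
    by (simp add: is_boundary_measure_def)
  then show "sets (boundary_measure :: 'a letter stream measure) = sigma_sets boundary (cyl ` carrier free_group)"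
    by (simp add: sets_boundary_borel)
  show "space (boundary_measure :: 'a letter stream measure) = boundary"
    using sets_eq_imp_space_eq[OF s] by simp
qed

lemma emeasure_boundary_measure_cyl:
  assumes "reduced_word u" "u \<noteq> []"
  shows "emeasure boundary_measure (cyl u :: 'a::finite letter stream set) =
    ennreal (1 / (2 * real CARD('a) * (2 * real CARD('a) - 1) ^ (length u - 1)))"
proof -
  interpret prob_space "boundary_measure :: 'a letter stream measure"
    by (rule prob_space_boundary_measure)
  show ?thesis
    using is_boundary_measure_cyl[OF is_boundary_measure_boundary_measure assms]
    by (simp add: emeasure_eq_measure)
qed

lemma cyl_sets [measurable]:
  "reduced_word u \<Longrightarrow> cyl u \<in> sets (boundary_measure :: 'a::finite letter stream measure)"
  by (auto simp: sets_boundary_measure)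

section \<open>Measurability of prefixes, overlaps and the action\<close>

lemma measurable_stake [measurable]:
  "stake k \<in> measurable (boundary_measure :: 'a::finite letter stream measure) (count_space UNIV)"
proof (subst measurable_count_space_eq_countable)
  show "countable (UNIV :: 'a letter list set)" by simp
  have "stake k -` {u} \<inter> space boundary_measure \<in> sets boundary_measure" for u :: "'a letter list"
  proof (cases "length u = k \<and> reduced_word u")
    case True
    then have "stake k -` {u} \<inter> space boundary_measure = cyl u"
      by (auto simp: cyl_eq)
    then show ?thesis using True by simp
  next
    case False
    then have "stake k -` {u} \<inter> space boundary_measure = {}"
      by (auto simp: reduced_word_stake)
    then show ?thesis by (simp only: sets.empty_sets)
  qed
  then show "stake k \<in> space boundary_measure \<rightarrow> UNIV \<and>
      (\<forall>u\<in>UNIV. stake k -` {u} \<inter> space boundary_measure \<in> sets (boundary_measure :: 'a letter stream measure))"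
    by simp
qed

lemma measurable_overlaps [measurable]:
  "Measurable.pred (boundary_measure :: 'a::finite letter stream measure) (overlaps k u)"
  unfolding overlaps_def[abs_def] by measurable

text \<open>A result starting with \<open>y \<noteq> x\<close> arises only by cancellation. For
  \<open>y = x\<close> the letter was prepended, since a cancellation would need the nonreduced
  start \<open>inv_letter x\<close>, \<open>x\<close>. If \<open>u\<close> is nonempty, its first
  letter is already different from \<open>inv_letter x\<close>; for \<open>u = []\<close> this must
  be imposed, whence the complement.\<close>

lemma red_SCons_vimage_cyl:
  assumes "reduced_word (y # u)"
  shows "red_SCons x -` cyl (y # u) \<inter> boundary =
    (if y \<noteq> x then cyl (inv_letter x # y # u)
     else if u = [] then boundary - cyl [inv_letter x] else cyl u)"
proof -
  have "red_SCons x \<omega> \<in> cyl (y # u) \<longleftrightarrow> \<omega> \<in> (if y \<noteq> x then cyl (inv_letter x # y # u)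
     else if u = [] then boundary - cyl [inv_letter x] else cyl u)" if \<omega>: "\<omega> \<in> boundary" for \<omega>
  proof -
    obtain z \<eta> where z: "\<omega> = z ## \<eta>" by (cases \<omega>)
    have "shd \<eta> \<noteq> inv_letter z" "\<eta> \<in> boundary" using \<omega> by (simp_all add: z boundary_SCons)
    moreover have "reduced_word u" "u \<noteq> [] \<longrightarrow> hd u \<noteq> inv_letter y"
      using assms by (simp_all add: reduced_word_Cons)
    ultimately show ?thesis
      using assms \<omega>
      by (cases u) (auto simp: z cyl_eq red_SCons_def reduced_word_Cons boundary_SCons)
  qed
  then show ?thesis
    using cyl_subset[of u] cyl_subset[of "inv_letter x # y # u"] by (auto split: if_splits)
qed

lemma measurable_red_SCons [measurable]:
  "red_SCons x \<in> measurable (boundary_measure :: 'a::finite letter stream measure) boundary_measure"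
proof (rule measurable_sigma_sets[OF sets_boundary_measure])
  show "cyl ` carrier free_group \<subseteq> Pow (boundary :: 'a letter stream set)"
    using cyl_subset by blast
  show "red_SCons x \<in> space boundary_measure \<rightarrow> boundary" by (simp add: red_SCons_boundary)
  fix Y :: "'a letter stream set" assume "Y \<in> cyl ` carrier free_group"
  then obtain u where u: "reduced_word u" "Y = cyl u" by auto
  show "red_SCons x -` Y \<inter> space boundary_measure \<in> sets boundary_measure"
  proof (cases u)
    case Nil
    then have "red_SCons x -` Y \<inter> space boundary_measure = space boundary_measure"
      using u by (auto simp: red_SCons_boundary)
    then show ?thesis by (metis sets.top)
  next
    case (Cons y v)
    have "cyl [inv_letter x] \<in> sets boundary_measure"
        "(boundary :: 'a letter stream set) \<in> sets boundary_measure"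
      using sets.top[of "boundary_measure :: 'a letter stream measure"]
      by (auto simp: reduced_word_Cons)
    then show ?thesis
      using u Cons red_SCons_vimage_cyl[of y v x] by (auto simp: reduced_word_Cons)
  qed
qed

lemma measurable_boundary_act [measurable]:
  "boundary_act u \<in> measurable (boundary_measure :: 'a::finite letter stream measure) boundary_measure"
proof (induction u)
  case (Cons x u)
  then show ?case
    using measurable_compose[OF Cons measurable_red_SCons[of x]] by simp
qed (simp add: boundary_act_def)

section \<open>Density of a single letter and quasi-invariance\<close>

text \<open>The boundary is the finite disjoint union of the one-letter cylinders, so agreement on
  nonempty words forces equal total mass; the cylinders then form a generator stable under
  intersection, up to the empty set.\<close>

lemma boundary_measure_eqI:
  fixes M N :: "'a::finite letter stream measure"
  assumes "finite_measure M" and sM: "sets M = sets boundary_measure" and sN: "sets N = sets boundary_measure"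
    and eq: "\<And>u. reduced_word u \<Longrightarrow> u \<noteq> [] \<Longrightarrow> emeasure M (cyl u) = emeasure N (cyl u)"
  shows "M = N"
proof -
  interpret finite_measure M by fact
  let ?E = "insert {} (cyl ` carrier free_group) :: 'a letter stream set set"
  have sE: "sigma_sets boundary ?E = sigma_sets boundary (cyl ` carrier free_group)"
    by (rule sigma_sets_eqI) (auto intro: sigma_sets.intros)
  have total: "emeasure L boundary = (\<Sum>x\<in>UNIV. emeasure L (cyl [x]))"
    if "sets L = sets boundary_measure" for L :: "'a letter stream measure"
  proof -
    have *: "reduced_word [x]" for x :: "'a letter" by (simp add: reduced_word_Cons)
    have "(\<Sum>x\<in>UNIV. emeasure L (cyl [x])) = emeasure L (\<Union>x\<in>UNIV. cyl [x])"
    proof (rule sum_emeasure)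
      show "range (\<lambda>x. cyl [x]) \<subseteq> sets L" using cyl_sets[OF *] by (auto simp: that)
      show "disjoint_family (\<lambda>x. cyl [x] :: 'a letter stream set)"
        by (auto simp: disjoint_family_on_def cyl_eq *)
    qed simp
    also have "(\<Union>x\<in>UNIV. cyl [x]) = (boundary :: 'a letter stream set)"
      by (auto simp: cyl_eq reduced_word_Cons)
    finally show ?thesis ..
  qed
  show ?thesis
  proof (rule measure_eqI_generator_eq[where E = ?E and \<Omega> = boundary and A = "\<lambda>_. boundary"])
    show "Int_stable ?E"
    proof (rule Int_stableI)
      fix a b assume "a \<in> ?E" "b \<in> ?E"
      then consider "a \<inter> b = {}" | g h where "reduced_word g" "reduced_word h" "a = cyl g" "b = cyl h"
        by auto
      then show "a \<inter> b \<in> ?E"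
      proof cases
        case 2
        then show ?thesis using cyl_Int[OF 2(1,2)] carrier_free_group by blast
      qed simp
    qed
    show "?E \<subseteq> Pow boundary" using cyl_subset by blast
    show "sets M = sigma_sets boundary ?E" "sets N = sigma_sets boundary ?E"
      unfolding sM sN sE sets_boundary_measure by simp_all
    show "range (\<lambda>_. boundary) \<subseteq> ?E"
      using cyl_Nil reduced_word_Nil by (auto intro!: rev_image_eqI[of "[]"])
    show "emeasure M X = emeasure N X" if X: "X \<in> ?E" for X
    proof -
      consider "X = {}" | u where "reduced_word u" "X = cyl u" using X by auto
      then show ?thesis
      proof cases
        case 2
        then show ?thesis
          using total[OF sM] total[OF sN] eq by (cases "u = []") (auto simp: reduced_word_Cons)
      qed simp
    qed
  qed (simp_all add: emeasure_eq_measure)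
qed

text \<open>This is the Radon-Nikodym derivative for one letter. The preimage of a cylinder is a
  cylinder one letter longer or shorter, or the complement of a one-letter cylinder; in each case
  its mass changes by a factor \<open>q\<close> or \<open>1 / q\<close>.\<close>

lemma distr_red_SCons:
  fixes x :: "'a::finite letter"
  defines "q \<equiv> 2 * real CARD('a) - 1"
  shows "distr boundary_measure boundary_measure (red_SCons x) =
    density boundary_measure (\<lambda>\<omega>. ennreal (if stake 1 \<omega> = [x] then q else 1 / q))"
    (is "?D = density _ (\<lambda>\<omega>. ennreal (?p \<omega>))")
proof (rule boundary_measure_eqI)
  interpret prob_space "boundary_measure :: 'a letter stream measure"
    by (rule prob_space_boundary_measure)
  have q: "q > 0" unfolding q_def using CARD_pos[where 'a='a] by simp
  show "finite_measure ?D"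
    by (rule finite_measure_distr) measurable
  fix u :: "'a letter list" assume u: "reduced_word u" "u \<noteq> []"
  then obtain y v where yv: "u = y # v" by (cases u) auto
  have cylq: "emeasure boundary_measure (cyl w) = ennreal (1 / ((q + 1) * q ^ (length w - 1)))"
    if "reduced_word w" "w \<noteq> []" for w :: "'a letter list"
    using emeasure_boundary_measure_cyl[OF that] by (simp add: q_def)
  have "emeasure (density boundary_measure (\<lambda>\<omega>. ennreal (?p \<omega>))) (cyl u) =
      (\<integral>\<^sup>+\<omega>. ennreal (?p \<omega>) * indicator (cyl u) \<omega> \<partial>boundary_measure)"
    using u by (intro emeasure_density) measurable
  also have "\<dots> = (\<integral>\<^sup>+\<omega>. ennreal (if y = x then q else 1 / q) * indicator (cyl u) \<omega> \<partial>boundary_measure)"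
    using u by (intro nn_integral_cong) (auto simp: yv cyl_eq split: split_indicator)
  also have "\<dots> = ennreal (if y = x then q else 1 / q) * emeasure boundary_measure (cyl u)"
    using u by (intro nn_integral_cmult_indicator) measurable
  also have "\<dots> = ennreal ((if y = x then q else 1 / q) * (1 / ((q + 1) * q ^ length v)))"
    using u q by (subst cylq) (auto simp: yv ennreal_mult'[symmetric])
  finally have R: "emeasure (density boundary_measure (\<lambda>\<omega>. ennreal (?p \<omega>))) (cyl u) = \<dots>" .
  have L: "emeasure ?D (cyl u) = emeasure boundary_measure (red_SCons x -` cyl u \<inter> boundary)"
    using u by (subst emeasure_distr) auto
  show "emeasure ?D (cyl u) = emeasure (density boundary_measure (\<lambda>\<omega>. ennreal (?p \<omega>))) (cyl u)"
  proof -
    consider "y \<noteq> x" | "y = x" "v = []" | "y = x" "v \<noteq> []" by blast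
    then show ?thesis
    proof cases
      case 1
      then have "reduced_word (inv_letter x # u)"
        using u by (simp add: yv reduced_word_Cons)
      then show ?thesis
        using 1 u q unfolding L R by (simp add: yv red_SCons_vimage_cyl cylq field_simps)
    next
      case 2
      \<comment> \<open>The complement has mass \<open>q / (q + 1)\<close>, which is
        \<open>q\<close> times the mass of \<open>cyl [x]\<close>.\<close>
      have "emeasure boundary_measure (boundary - cyl [inv_letter x]) =
          emeasure boundary_measure (boundary :: 'a letter stream set) -
          emeasure boundary_measure (cyl [inv_letter x])"
        using cyl_subset[of "[inv_letter x]"] sets.top[of "boundary_measure :: 'a letter stream measure"]
        by (subst emeasure_Diff) (auto simp: emeasure_eq_measure reduced_word_Cons)
      also have "\<dots> = ennreal (1 - 1 / (q + 1))"
        using emeasure_space_1 q by (simp add: cylq reduced_word_Cons ennreal_minus flip: ennreal_1)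
      also have "1 - 1 / (q + 1) = q / (q + 1)" using q by (simp add: field_simps)
      finally show ?thesis
        using 2 u unfolding L R by (simp add: yv red_SCons_vimage_cyl)
    next
      case 3
      \<comment> \<open>The mass of \<open>cyl v\<close> involves the truncated exponent
        \<open>length v - 1\<close>; as \<open>v\<close> is nonempty, this is a true predecessor and
        the extra factor \<open>q\<close> appears.\<close>
      then have "reduced_word v" "length v = Suc (length v - 1)"
        using u by (simp_all add: yv reduced_word_Cons)
      then have "q ^ length v = q * q ^ (length v - 1)" by (metis power_Suc)
      then show ?thesis
        using 3 u q \<open>reduced_word v\<close> unfolding L R by (simp add: yv red_SCons_vimage_cyl cylq)
    qed
  qed
qed simp_all

text \<open>Quasi-invariance, letter by letter: the density for \<open>red_SCons x\<close> makes the
  preimage under the outermost letter null, and induction treats the remaining letters.\<close>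

lemma null_sets_vimage_boundary_act:
  assumes "E \<in> null_sets (boundary_measure :: 'a::finite letter stream measure)"
  shows "boundary_act u -` E \<inter> boundary \<in> null_sets boundary_measure"
  using assms
proof (induction u arbitrary: E)
  case Nil
  then show ?case
    using sets.sets_into_space[of E boundary_measure] by (auto simp: Int_absorb2 null_sets_def)
next
  case (Cons x u)
  have "absolutely_continuous boundary_measure
      (distr boundary_measure boundary_measure (red_SCons x))"
    unfolding distr_red_SCons by (rule absolutely_continuousI_density) measurable
  then have "E \<in> null_sets (distr boundary_measure boundary_measure (red_SCons x))"
    using Cons.prems unfolding absolutely_continuous_def by blast
  then have "red_SCons x -` E \<inter> boundary \<in> null_sets boundary_measure"
    by (subst (asm) null_sets_distr_iff) auto
  from Cons.IH[OF this]
  have "boundary_act u -` (red_SCons x -` E \<inter> boundary) \<inter> boundary \<in> null_sets boundary_measure" .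
  also have "boundary_act u -` (red_SCons x -` E \<inter> boundary) \<inter> boundary = boundary_act (x # u) -` E \<inter> boundary"
    by (auto simp: boundary_act_boundary)
  finally show ?case .
qed

text \<open>Change of variables. The inequality suffices for a norm bound and avoids discussing
  where the derivative is infinite: \<open>enn2real\<close> sends infinity to 0, so
  \<open>poisson\<close> never exceeds the derivative.\<close>

lemma nn_integral_poisson_le:
  fixes v :: "'a::finite letter stream \<Rightarrow> ennreal"
  assumes [measurable]: "v \<in> borel_measurable boundary_measure"
  shows "(\<integral>\<^sup>+\<omega>. ennreal (poisson u \<omega>) * v \<omega> \<partial>boundary_measure) \<le>
    (\<integral>\<^sup>+\<omega>. v (boundary_act u \<omega>) \<partial>boundary_measure)"
proof -
  interpret prob_space "boundary_measure :: 'a letter stream measure"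
    by (rule prob_space_boundary_measure)
  let ?N = "distr boundary_measure boundary_measure (boundary_act u) :: 'a letter stream measure"
  let ?D = "RN_deriv boundary_measure ?N"
  have "absolutely_continuous boundary_measure ?N"
    unfolding absolutely_continuous_def
    using null_sets_vimage_boundary_act by (auto simp: null_sets_distr_iff null_setsD2)
  then have D: "density boundary_measure ?D = ?N" by (intro density_RN_deriv) simp_all
  have "(\<integral>\<^sup>+\<omega>. ennreal (poisson u \<omega>) * v \<omega> \<partial>boundary_measure) \<le>
      (\<integral>\<^sup>+\<omega>. ?D \<omega> * v \<omega> \<partial>boundary_measure)"
    unfolding poisson_def
    by (intro nn_integral_mono mult_right_mono) (auto simp: ennreal_enn2real_if)
  also have "\<dots> = (\<integral>\<^sup>+\<omega>. v \<omega> \<partial>density boundary_measure ?D)"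
    by (intro nn_integral_density[symmetric]) measurable
  also have "\<dots> = (\<integral>\<^sup>+\<omega>. v (boundary_act u \<omega>) \<partial>boundary_measure)"
    unfolding D by (intro nn_integral_distr) measurable
  finally show ?thesis .
qed


section \<open>The norm estimate\<close>

lemma word_sphere_eq: "word_sphere n = {u. reduced_word u \<and> length u = n}"
  by (auto simp: word_sphere_def word_length_eq)

lemma finite_word_sphere [simp]: "finite (word_sphere n :: 'a::finite letter list set)"
  by (rule finite_subset[OF _ finite_lists_length_eq[of UNIV n]]) (auto simp: word_sphere_eq)

lemma measurable_quasi_reg [measurable]:
  assumes [measurable]: "\<phi> \<in> borel_measurable (boundary_measure :: 'a::finite letter stream measure)"
  shows "quasi_reg u \<phi> \<in> borel_measurable boundary_measure"
  unfolding quasi_reg_def[abs_def] poisson_def by measurable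

lemma quasi_reg_norm_sq:
  "reduced_word u \<Longrightarrow>
    (cmod (quasi_reg u \<phi> \<omega>))\<^sup>2 = poisson u \<omega> * (cmod (\<phi> (boundary_act (inv_word u) \<omega>)))\<^sup>2"
  by (simp add: quasi_reg_def inv_free_group norm_mult power_mult_distrib poisson_def)

text \<open>
  After the change of variables \<open>\<omega> \<mapsto> u\<omega>\<close>, the term of \<open>u\<close> is the mass of \<open>\<phi>\<close> on a part of
  the cylinder of \<open>inv_word (drop k u)\<close>; these are disjoint for distinct \<open>u\<close> with prefix \<open>g\<close>.
\<close>

lemma nn_integral_overlaps_le:
  fixes \<phi> :: "'a::finite letter stream \<Rightarrow> complex"
  assumes [measurable]: "\<phi> \<in> borel_measurable boundary_measure"
  shows "(\<integral>\<^sup>+\<omega>. of_bool (stake k \<omega> = g) *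
      (\<Sum>u\<in>word_sphere n. of_bool (overlaps k u \<omega>) * ennreal ((cmod (quasi_reg u \<phi> \<omega>))\<^sup>2)) \<partial>boundary_measure)
    \<le> (\<integral>\<^sup>+\<omega>. ennreal ((cmod (\<phi> \<omega>))\<^sup>2) \<partial>boundary_measure)" (is "?L \<le> ?R")
proof -
  let ?S = "{u \<in> word_sphere n. take k u = g}"
  let ?v = "\<lambda>u \<omega>. of_bool (overlaps k u \<omega>) * ennreal ((cmod (\<phi> (boundary_act (inv_word u) \<omega>)))\<^sup>2)"
  have "?L = (\<integral>\<^sup>+\<omega>. (\<Sum>u\<in>word_sphere n. of_bool (stake k \<omega> = g) *
      (of_bool (overlaps k u \<omega>) * ennreal ((cmod (quasi_reg u \<phi> \<omega>))\<^sup>2))) \<partial>boundary_measure)"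
    by (simp only: sum_distrib_left)
  also have "\<dots> \<le> (\<integral>\<^sup>+\<omega>. (\<Sum>u\<in>?S. ennreal (poisson u \<omega>) * ?v u \<omega>) \<partial>boundary_measure)"
  proof (intro nn_integral_mono)
    fix \<omega> :: "'a letter stream"
    \<comment> \<open>If \<open>\<omega>\<close> starts with \<open>g\<close> and overlaps
      \<open>u\<close> in \<open>k\<close> letters, then \<open>take k u = g\<close>; all other
      words contribute 0.\<close>
    have "(\<Sum>u\<in>word_sphere n. of_bool (stake k \<omega> = g) *
        (of_bool (overlaps k u \<omega>) * ennreal ((cmod (quasi_reg u \<phi> \<omega>))\<^sup>2))) =
      (\<Sum>u\<in>?S. of_bool (stake k \<omega> = g) *
        (of_bool (overlaps k u \<omega>) * ennreal ((cmod (quasi_reg u \<phi> \<omega>))\<^sup>2)))"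
      by (intro sum.mono_neutral_right) (auto simp: overlaps_def)
    also have "\<dots> \<le> (\<Sum>u\<in>?S. ennreal (poisson u \<omega>) * ?v u \<omega>)"
      by (intro sum_mono)
        (auto simp: word_sphere_eq quasi_reg_norm_sq poisson_def ennreal_mult)
    finally show "(\<Sum>u\<in>word_sphere n. of_bool (stake k \<omega> = g) *
        (of_bool (overlaps k u \<omega>) * ennreal ((cmod (quasi_reg u \<phi> \<omega>))\<^sup>2))) \<le>
      (\<Sum>u\<in>?S. ennreal (poisson u \<omega>) * ?v u \<omega>)" .
  qed
  also have "\<dots> = (\<Sum>u\<in>?S. \<integral>\<^sup>+\<omega>. ennreal (poisson u \<omega>) * ?v u \<omega> \<partial>boundary_measure)"
    unfolding poisson_def by (intro nn_integral_sum) measurable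
  \<comment> \<open>After this substitution \<open>inv_word u\<close> undoes \<open>u\<close>, so
    every term is the same function of \<open>\<omega>\<close>, restricted to a set depending on
    \<open>u\<close>.\<close>
  also have "\<dots> \<le> (\<Sum>u\<in>?S. \<integral>\<^sup>+\<omega>. ?v u (boundary_act u \<omega>) \<partial>boundary_measure)"
    by (intro sum_mono nn_integral_poisson_le) measurable
  also have "\<dots> = (\<integral>\<^sup>+\<omega>. (\<Sum>u\<in>?S. ?v u (boundary_act u \<omega>)) \<partial>boundary_measure)"
    by (intro nn_integral_sum[symmetric]) measurable
  also have "\<dots> \<le> ?R"
  proof (intro nn_integral_mono)
    fix \<omega> :: "'a letter stream" assume "\<omega> \<in> space boundary_measure"
    then have \<omega>: "\<omega> \<in> boundary" by simp
    let ?S' = "{u \<in> ?S. overlaps k u (boundary_act u \<omega>)}"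
    \<comment> \<open>The tail of \<open>u\<close> is read off from the first \<open>n - k\<close>
      letters of \<open>\<omega>\<close> and its head is \<open>g\<close>, so at most one word
      contributes at each point.\<close>
    have inj: "u = u'" if "u \<in> ?S'" "u' \<in> ?S'" for u u'
    proof -
      have "inv_word (drop k u) = inv_word (drop k u')"
        using that overlaps_boundary_act_stake[of u \<omega> k] overlaps_boundary_act_stake[of u' \<omega> k] \<omega>
        by (simp add: word_sphere_eq)
      then have "drop k u = drop k u'"
        by (metis inv_word_def rev_rev_ident inj_map_eq_map inj_on_inverseI inv_letter_inv_letter)
      moreover have "take k u = take k u'" using that by simp
      ultimately show ?thesis by (metis append_take_drop_id)
    qed
    have "(\<Sum>u\<in>?S. ?v u (boundary_act u \<omega>)) = (\<Sum>u\<in>?S'. ennreal ((cmod (\<phi> \<omega>))\<^sup>2))"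
      by (intro sum.mono_neutral_cong_right) (auto simp: boundary_act_inv_word[OF \<omega>])
    also have "\<dots> \<le> ennreal ((cmod (\<phi> \<omega>))\<^sup>2)"
    proof (cases "?S' = {}")
      case False
      then obtain u where "u \<in> ?S'" by blast
      then have "?S' = {u}" using inj by blast
      then show ?thesis by (simp only: sum.insert sum.empty finite.emptyI) simp
    qed (simp only: sum.empty zero_le)
    finally show "(\<Sum>u\<in>?S. ?v u (boundary_act u \<omega>)) \<le> ennreal ((cmod (\<phi> \<omega>))\<^sup>2)" .
  qed
  finally show ?thesis .
qed

section \<open>Pointwise estimate and its integration\<close>

text \<open>Cauchy-Schwarz is used twice: across the levels, which costs the factor
  \<open>n + 1\<close>, and within each level, which separates the coefficients \<open>c\<close>
  from \<open>b\<close>.\<close>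

lemma sum_overlaps_norm_sq_le:
  fixes c b :: "'a::finite letter list \<Rightarrow> complex"
  shows "(cmod (\<Sum>u\<in>word_sphere n. c u * b u))\<^sup>2 \<le>
    real (n + 1) * (\<Sum>k\<le>n. (\<Sum>u\<in>word_sphere n. (cmod (c u))\<^sup>2 * of_bool (stake k \<omega> = take k u)) *
      (\<Sum>u\<in>word_sphere n. of_bool (overlaps k u \<omega>) * (cmod (b u))\<^sup>2))"
proof -
  let ?S = "word_sphere n :: 'a letter list set"
  let ?o = "\<lambda>k u. of_bool (overlaps k u \<omega>) :: real"
  let ?A = "\<lambda>k. \<Sum>u\<in>?S. (?o k u * cmod (c u)) * (?o k u * cmod (b u))"
  have "cmod (\<Sum>u\<in>?S. c u * b u) \<le> (\<Sum>u\<in>?S. cmod (c u) * cmod (b u))"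
    by (rule order_trans[OF norm_sum]) (simp add: norm_mult)
  \<comment> \<open>Every word of length \<open>n\<close> has an overlap of some level
    \<open>k \<le> n\<close>. The indicator equals its square, so each Cauchy-Schwarz factor
    receives a copy.\<close>
  also have "\<dots> \<le> (\<Sum>u\<in>?S. \<Sum>k\<le>n. (?o k u * cmod (c u)) * (?o k u * cmod (b u)))"
  proof (rule sum_mono)
    fix u :: "'a letter list" assume "u \<in> ?S"
    then obtain j where j: "j \<le> n" "overlaps j u \<omega>"
      using overlaps_ex[of u \<omega>] by (auto simp: word_sphere_eq)
    have "cmod (c u) * cmod (b u) = (?o j u * cmod (c u)) * (?o j u * cmod (b u))"
      using j by simp
    also have "\<dots> \<le> (\<Sum>k\<le>n. (?o k u * cmod (c u)) * (?o k u * cmod (b u)))"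
      using j by (intro member_le_sum) auto
    finally show "cmod (c u) * cmod (b u) \<le> \<dots>" .
  qed
  also have "\<dots> = (\<Sum>k\<le>n. ?A k)" by (rule sum.swap)
  finally have "(cmod (\<Sum>u\<in>?S. c u * b u))\<^sup>2 \<le> (\<Sum>k\<le>n. ?A k)\<^sup>2"
    by (intro power_mono) auto
  also have "\<dots> \<le> real (n + 1) * (\<Sum>k\<le>n. (?A k)\<^sup>2)"
    using sum_squared_le_sum_of_squares[of ?A "{..n}"] by (simp add: mult.commute)
  also have "\<dots> \<le> real (n + 1) * (\<Sum>k\<le>n. (\<Sum>u\<in>?S. (cmod (c u))\<^sup>2 * of_bool (stake k \<omega> = take k u)) *
      (\<Sum>u\<in>?S. ?o k u * (cmod (b u))\<^sup>2))"
  proof (intro mult_left_mono sum_mono)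
    fix k
    have "(?A k)\<^sup>2 \<le> (\<Sum>u\<in>?S. (?o k u * cmod (c u))\<^sup>2) * (\<Sum>u\<in>?S. (?o k u * cmod (b u))\<^sup>2)"
      by (rule Cauchy_Schwarz_ineq_sum)
    \<comment> \<open>In the coefficient factor the overlap is relaxed to agreement of prefixes, a
      condition that depends on \<open>\<omega>\<close> only through its first \<open>k\<close>
      letters.\<close>
    also have "\<dots> \<le> (\<Sum>u\<in>?S. (cmod (c u))\<^sup>2 * of_bool (stake k \<omega> = take k u)) *
        (\<Sum>u\<in>?S. ?o k u * (cmod (b u))\<^sup>2)"
      by (intro mult_mono sum_mono sum_nonneg) (auto simp: overlaps_def)
    finally show "(?A k)\<^sup>2 \<le> \<dots>" .
  qed simp
  finally show ?thesis .
qed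

text \<open>The pointwise estimate is integrated separately for each level \<open>k\<close> and word
  \<open>u\<close>; \<open>nn_integral_overlaps_le\<close> with \<open>g = take k u\<close> bounds
  every such integral by the squared norm of \<open>\<phi>\<close>.\<close>

lemma nn_integral_quasi_reg_sum_le:
  fixes f :: "'a::finite letter list \<Rightarrow> complex"
  assumes [measurable]: "\<phi> \<in> borel_measurable boundary_measure"
  shows "(\<integral>\<^sup>+\<omega>. ennreal ((cmod (\<Sum>u\<in>word_sphere n. f u * quasi_reg u \<phi> \<omega>))\<^sup>2) \<partial>boundary_measure) \<le>
    ennreal ((real (n + 1))\<^sup>2 * (\<Sum>u\<in>word_sphere n. (cmod (f u))\<^sup>2)) *
    (\<integral>\<^sup>+\<omega>. ennreal ((cmod (\<phi> \<omega>))\<^sup>2) \<partial>boundary_measure)" (is "?L \<le> _ * ?R")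
proof -
  let ?S = "word_sphere n :: 'a letter list set"
  let ?B = "\<lambda>k \<omega>. \<Sum>u\<in>?S. of_bool (overlaps k u \<omega>) * ennreal ((cmod (quasi_reg u \<phi> \<omega>))\<^sup>2)"
  let ?F = "\<Sum>u\<in>?S. ennreal ((cmod (f u))\<^sup>2)"
  have of_bool_ennreal: "ennreal (of_bool P) = of_bool P" for P by simp
  have "?L \<le> (\<integral>\<^sup>+\<omega>. ennreal (real (n + 1)) * (\<Sum>k\<le>n. \<Sum>u\<in>?S. ennreal ((cmod (f u))\<^sup>2) *
      (of_bool (stake k \<omega> = take k u) * ?B k \<omega>)) \<partial>boundary_measure)"
  proof (intro nn_integral_mono)
    fix \<omega> :: "'a letter stream"
    have "ennreal ((cmod (\<Sum>u\<in>?S. f u * quasi_reg u \<phi> \<omega>))\<^sup>2) \<le>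
      ennreal (real (n + 1) * (\<Sum>k\<le>n. (\<Sum>u\<in>?S. (cmod (f u))\<^sup>2 * of_bool (stake k \<omega> = take k u)) *
      (\<Sum>u\<in>?S. of_bool (overlaps k u \<omega>) * (cmod (quasi_reg u \<phi> \<omega>))\<^sup>2)))"
      by (intro ennreal_leI sum_overlaps_norm_sq_le)
    also have "\<dots> = ennreal (real (n + 1)) *
        (\<Sum>k\<le>n. (\<Sum>u\<in>?S. ennreal ((cmod (f u))\<^sup>2) * of_bool (stake k \<omega> = take k u)) * ?B k \<omega>)"
      by (simp add: ennreal_mult sum_nonneg sum_ennreal[symmetric] of_bool_ennreal
          del: sum_ennreal of_nat_Suc of_nat_add sum_mult_of_bool_eq sum_of_bool_mult_eq)
    finally show "ennreal ((cmod (\<Sum>u\<in>?S. f u * quasi_reg u \<phi> \<omega>))\<^sup>2) \<le>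
        ennreal (real (n + 1)) * (\<Sum>k\<le>n. \<Sum>u\<in>?S. ennreal ((cmod (f u))\<^sup>2) *
          (of_bool (stake k \<omega> = take k u) * ?B k \<omega>))"
      by (simp only: sum_distrib_right mult.assoc)
  qed
  also have "\<dots> = ennreal (real (n + 1)) * (\<Sum>k\<le>n. \<Sum>u\<in>?S. ennreal ((cmod (f u))\<^sup>2) *
      (\<integral>\<^sup>+\<omega>. of_bool (stake k \<omega> = take k u) * ?B k \<omega> \<partial>boundary_measure))"
  proof -
    have *: "(\<integral>\<^sup>+\<omega>. C * (\<Sum>k\<le>n. \<Sum>u\<in>?S. a u * b k u \<omega>) \<partial>M) =
        C * (\<Sum>k\<le>n. \<Sum>u\<in>?S. a u * (\<integral>\<^sup>+\<omega>. b k u \<omega> \<partial>M))"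
      if "\<And>k u. b k u \<in> borel_measurable M" for C a b and M :: "'a letter stream measure"
      using that by (simp add: nn_integral_cmult nn_integral_sum)
    show ?thesis by (rule *) measurable
  qed
  also have "\<dots> \<le> ennreal (real (n + 1)) * (\<Sum>k\<le>n. \<Sum>u\<in>?S. ennreal ((cmod (f u))\<^sup>2) * ?R)"
    by (intro mult_left_mono sum_mono nn_integral_overlaps_le) auto
  \<comment> \<open>The bound is the same at all levels, so the sum over \<open>k\<close> produces
    the second factor \<open>n + 1\<close>.\<close>
  also have "\<dots> = ennreal (real (n + 1)) * (ennreal (real (n + 1)) * (?F * ?R))"
    by (simp add: sum_distrib_right ennreal_of_nat_eq_real_of_nat del: sum_ennreal)
  also have "\<dots> = ennreal ((real (n + 1))\<^sup>2 * (\<Sum>u\<in>?S. (cmod (f u))\<^sup>2)) * ?R"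
  proof -
    have F: "?F = ennreal (\<Sum>u\<in>?S. (cmod (f u))\<^sup>2)" by (rule sum_ennreal) simp
    show ?thesis
      unfolding F power2_eq_square[of "real (n + 1)"]
      by (simp add: ennreal_mult sum_nonneg mult.assoc del: of_nat_Suc of_nat_add)
  qed
  finally show ?thesis .
qed

section \<open>From integrals to the operator norm\<close>

lemma L2_iff_nn_integral:
  "\<phi> \<in> L2 M \<longleftrightarrow> \<phi> \<in> borel_measurable M \<and> (\<integral>\<^sup>+x. ennreal ((cmod (\<phi> x))\<^sup>2) \<partial>M) < \<infinity>"
  by (auto simp: L2_def integrable_iff_bounded)

lemma L2_norm_nn_integral:
  assumes "\<phi> \<in> L2 M"
  shows "(\<integral>\<^sup>+x. ennreal ((cmod (\<phi> x))\<^sup>2) \<partial>M) = ennreal ((L2_norm M \<phi>)\<^sup>2)"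
  using assms by (simp add: L2_def L2_norm_def nn_integral_eq_integral)

lemma ell2_norm_eq_sum:
  fixes f :: "'a::finite letter list \<Rightarrow> complex"
  assumes "{\<gamma>. f \<gamma> \<noteq> 0} \<subseteq> word_sphere n"
  shows "ell2_norm f = sqrt (\<Sum>u\<in>word_sphere n. (cmod (f u))\<^sup>2)"
proof -
  have "(\<Sum>\<^sub>\<infinity>\<gamma>\<in>carrier free_group. (cmod (f \<gamma>))\<^sup>2) = (\<Sum>\<^sub>\<infinity>\<gamma>\<in>word_sphere n. (cmod (f \<gamma>))\<^sup>2)"
    using assms by (intro infsum_cong_neutral) (auto simp: word_sphere_def)
  then show ?thesis by (simp add: ell2_norm_def)
qed

text \<open>Preservation of \<open>L2\<close> belongs to the conclusion because
  \<open>L2_op_norm\<close> has its intended meaning only for maps of \<open>L2\<close> into itself.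
  Both parts follow from one bound on the integral of the squared modulus.\<close>

theorem mainTheorem1:
  fixes f :: "'a::finite letter list \<Rightarrow> complex" and n :: nat
  assumes "f \<in> group_algebra"
    and "{\<gamma>. f \<gamma> \<noteq> 0} \<subseteq> word_sphere n"
  shows "let \<pi>f = (\<lambda>\<phi> \<omega>. \<Sum>\<gamma>\<in>word_sphere n. f \<gamma> * quasi_reg \<gamma> \<phi> \<omega>)
    in (\<forall>\<phi> \<in> L2 boundary_measure. \<pi>f \<phi> \<in> L2 boundary_measure) \<and>
       L2_op_norm boundary_measure \<pi>f \<le> ennreal (real (n + 1) * ell2_norm f)"
proof -
  let ?T = "\<lambda>\<phi> \<omega>. \<Sum>\<gamma>\<in>word_sphere n. f \<gamma> * quasi_reg \<gamma> \<phi> \<omega>"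
  let ?C = "real (n + 1) * ell2_norm f"
  have C: "?C \<ge> 0" "?C\<^sup>2 = (real (n + 1))\<^sup>2 * (\<Sum>u\<in>word_sphere n. (cmod (f u))\<^sup>2)"
    by (simp_all add: ell2_norm_eq_sum[OF assms(2)] sum_nonneg power_mult_distrib)
  have bound: "(\<integral>\<^sup>+\<omega>. ennreal ((cmod (?T \<phi> \<omega>))\<^sup>2) \<partial>boundary_measure) \<le>
      ennreal (?C\<^sup>2 * (L2_norm boundary_measure \<phi>)\<^sup>2)" if "\<phi> \<in> L2 boundary_measure" for \<phi>
    using nn_integral_quasi_reg_sum_le[where \<phi> = \<phi> and n = n and f = f] that
    unfolding C(2)[symmetric] L2_norm_nn_integral[OF that]
    by (simp add: L2_def ennreal_mult)
  have L2: "?T \<phi> \<in> L2 boundary_measure" if "\<phi> \<in> L2 boundary_measure" for \<phi>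
  proof -
    have [measurable]: "\<phi> \<in> borel_measurable boundary_measure" using that by (simp add: L2_def)
    have "?T \<phi> \<in> borel_measurable boundary_measure" by measurable
    then show ?thesis
      unfolding L2_iff_nn_integral using bound[OF that] by (auto simp: less_top[symmetric] top_unique)
  qed
  have "L2_norm boundary_measure (?T \<phi>) \<le> ?C"
    if \<phi>: "\<phi> \<in> L2 boundary_measure" "L2_norm boundary_measure \<phi> \<le> 1" for \<phi>
  proof (rule power2_le_imp_le[OF _ C(1)])
    have "(L2_norm boundary_measure (?T \<phi>))\<^sup>2 \<le> ?C\<^sup>2 * (L2_norm boundary_measure \<phi>)\<^sup>2"
      using bound[OF \<phi>(1)] unfolding L2_norm_nn_integral[OF L2[OF \<phi>(1)]] by simp
    also have "\<dots> \<le> ?C\<^sup>2 * 1"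
      using \<phi>(2) by (intro mult_left_mono) (auto simp: L2_norm_def abs_square_le_1)
    finally show "(L2_norm boundary_measure (?T \<phi>))\<^sup>2 \<le> ?C\<^sup>2" by simp
  qed
  then have "L2_op_norm boundary_measure ?T \<le> ennreal ?C"
    unfolding L2_op_norm_def by (intro SUP_least) (auto intro: ennreal_leI)
  then show ?thesis using L2 by (simp add: Let_def)
qed

end
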